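(* Let $\mathfrak{Q}$ be a normal square functor. (1) Every $\Delta(\mathfrak{Q})$-Baire space is $\Delta(\mathfrak{Q})$-nonmeager. (2) Every nonempty open subset of a $\Delta(\mathfrak{Q})$-Baire space is (with the subspace topology) a $\Delta(\mathfrak{Q})$-Baire space. (3) A space $X$ is $\Delta(\mathfrak{Q})$-Baire if and only if every nonempty open subspace of $X$ is a $\Delta(\mathfrak{Q})$-nonmeager space. (4) A space $X$ is $\Delta(\mathfrak{Q})$-nonmeager if and only if there exists a nonempty open subspace of $X$ that is $\Delta(\mathfrak{Q})$-Baire. (5) A homogeneous $\Delta(\mathfrak{Q})$-nonmeager space is $\Delta(\mathfrak{Q})$-Baire.
   Context: Spaces are nonempty topological spaces; no separation axioms are assumed. For a set $X$, $P\subset X\times X$, $x\in X$, $M\subset X$ put $P(x)=\{y\in X:(x,y)\in P\}$ and $P|_M=P\cap(M\times M)$; for a family $\mathcal P$ of subsets of $X\times X$ put $\mathcal P|_M=\{P|_M:P\in\mathcal P\}$. A set $P\subset X\times X$ is a semi-neighborhood of the diagonal of a space $X$ if $x\in\operatorname{Int}P(x)$ for all $x\in X$. $\mathfrak S(X)$ is the family of all semi-neighborhoods of the diagonal of $X$. A square functor $\mathfrak Q$ assigns to each topological space $X$ a family $\mathfrak Q(X)$ of nonempty subsets of $X\times X$. It is a normal square functor if: (Q1) if $f:X\to Y$ is a homeomorphism, then $\mathfrak Q(Y)=\{(f\times f)(P):P\in\mathfrak Q(X)\}$; (Q2) if $U$ is a nonempty open subset of $X$, then $\mathfrak Q(U)=\mathfrak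 Q(X)|_U$; (Q3) if $S\in\mathfrak Q(X)$ and $S\subset Q\subset X\times X$, then $Q\in\mathfrak Q(X)$; (Q4) if $S\in\mathfrak Q(X)$, then $\overline S=X\times X$. A space $X$ is $\Delta(\mathfrak Q)$-nonmeager if for every $P\in\mathfrak S(X)$ there is a nonempty open $V\subset X$ with $P|_V\in\mathfrak Q(V)$. $X$ is $\Delta(\mathfrak Q)$-Baire if for every $P\in\mathfrak S(X)$ and every nonempty open $U\subset X$ there is a nonempty open $V\subset U$ with $P|_V\in\mathfrak Q(V)$. A space $X$ is homogeneous if for all $x,y\in X$ there is a homeomorphism of $X$ onto itself taking $x$ to $y$. *)

theory Defs
  imports "HOL-Analysis.Product_Topology"
begin

text \<open>
  A space is a value \<open>X :: 'a topology\<close> with nonempty \<open>topspace X\<close>. A square functor is a function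
  on all topologies whose points lie in the universe \<open>'a\<close>, which is an arbitrary type. Its values
  on the topology with empty carrier carry no meaning and are left unconstrained.
  For \<open>P \<subseteq> X \<times> X\<close>, the section \<open>P(x)\<close> is \<open>P `` {x}\<close> and \<open>P|\<^sub>M\<close> is \<open>Restr P M\<close>.
\<close>

definition square_functor :: "('a topology \<Rightarrow> ('a \<times> 'a) set set) \<Rightarrow> bool" where
  "square_functor \<QQ> \<longleftrightarrow>
     (\<forall>X. topspace X \<noteq> {} \<longrightarrow> (\<forall>S\<in>\<QQ> X. S \<noteq> {} \<and> S \<subseteq> topspace X \<times> topspace X))"

definition normal_square_functor :: "('a topology \<Rightarrow> ('a \<times> 'a) set set) \<Rightarrow> bool" where
  "normal_square_functor \<QQ> \<longleftrightarrow>
     square_functor \<QQ> \<and>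
     (\<forall>X Y f. topspace X \<noteq> {} \<and> topspace Y \<noteq> {} \<and> homeomorphic_map X Y f \<longrightarrow>
        \<QQ> Y = {map_prod f f ` P | P. P \<in> \<QQ> X}) \<and>
     (\<forall>X U. topspace X \<noteq> {} \<and> openin X U \<and> U \<noteq> {} \<longrightarrow>
        \<QQ> (subtopology X U) = {Restr P U | P. P \<in> \<QQ> X}) \<and>
     (\<forall>X S Q. topspace X \<noteq> {} \<and> S \<in> \<QQ> X \<and> S \<subseteq> Q \<and> Q \<subseteq> topspace X \<times> topspace X \<longrightarrow>
        Q \<in> \<QQ> X) \<and>
     (\<forall>X S. topspace X \<noteq> {} \<and> S \<in> \<QQ> X \<longrightarrow>
        prod_topology X X closure_of S = topspace X \<times> topspace X)"

definition semi_neighborhoods :: "'a topology \<Rightarrow> ('a \<times> 'a) set set" where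
  "semi_neighborhoods X =
     {P. P \<subseteq> topspace X \<times> topspace X \<and> (\<forall>x\<in>topspace X. x \<in> X interior_of (P `` {x}))}"

definition Delta_nonmeager :: "('a topology \<Rightarrow> ('a \<times> 'a) set set) \<Rightarrow> 'a topology \<Rightarrow> bool" where
  "Delta_nonmeager \<QQ> X \<longleftrightarrow>
     (\<forall>P\<in>semi_neighborhoods X.
        \<exists>V. openin X V \<and> V \<noteq> {} \<and> Restr P V \<in> \<QQ> (subtopology X V))"

definition Delta_Baire :: "('a topology \<Rightarrow> ('a \<times> 'a) set set) \<Rightarrow> 'a topology \<Rightarrow> bool" where
  "Delta_Baire \<QQ> X \<longleftrightarrow>
     (\<forall>P\<in>semi_neighborhoods X. \<forall>U. openin X U \<and> U \<noteq> {} \<longrightarrow>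
        (\<exists>V. openin X V \<and> V \<noteq> {} \<and> V \<subseteq> U \<and> Restr P V \<in> \<QQ> (subtopology X V)))"

definition homogeneous_space :: "'a topology \<Rightarrow> bool" where
  "homogeneous_space X \<longleftrightarrow>
     (\<forall>x\<in>topspace X. \<forall>y\<in>topspace X. \<exists>f. homeomorphic_map X X f \<and> f x = y)"

end

theory Submission
  imports Defs
begin

text \<open>
  Semi-neighborhoods of the diagonal are a local notion: they restrict to open subspaces, and one
  given on an open subspace \<open>U\<close> extends to the whole space by letting the section at each point
  outside \<open>U\<close> be everything. Hence \<open>\<Delta>(\<QQ>)\<close>-Baire means that every nonempty open subspace is
  \<open>\<Delta>(\<QQ>)\<close>-nonmeager, which gives the first three claims and one half of the fourth.

  The other half of the fourth claim is a form of Banach's category theorem. If no nonempty open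
  subspace is Baire, then every nonempty open set contains a nonempty open set \<open>V\<close> that is not
  nonmeager, as witnessed by some \<open>p V\<close>. These witnesses are glued into a single semi-neighborhood,
  whose section at \<open>x\<close> is that of \<open>p V\<close> for the first such \<open>V\<close> containing \<open>x\<close> in a fixed
  well-order. On any open set \<open>W\<close> the first \<open>V\<close> meeting \<open>W\<close> is the one chosen at all points of
  \<open>W \<inter> V\<close>, so there the glued relation is \<open>p V\<close>; as membership in \<open>\<QQ>\<close> passes to open subsets,
  the glued relation shows that the whole space is not nonmeager (lemma
  \<open>nonmeager_imp_open_Baire\<close>).

  For the last claim, homeomorphisms carry one open Baire subspace of a homogeneous space to open
  Baire subspaces meeting any prescribed open set.
\<close>

section \<open>Semi-neighborhoods and subspaces\<close>

lemma semi_neighborhoods_iff: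
  "P \<in> semi_neighborhoods X \<longleftrightarrow>
     P \<subseteq> topspace X \<times> topspace X \<and>
     (\<forall>x\<in>topspace X. \<exists>T. openin X T \<and> x \<in> T \<and> T \<subseteq> P `` {x})"
  by (auto simp: semi_neighborhoods_def interior_of_def)

lemma semi_neighborhoods_Restr:
  assumes P: "P \<in> semi_neighborhoods X" and U: "openin X U"
  shows "Restr P U \<in> semi_neighborhoods (subtopology X U)"
  unfolding semi_neighborhoods_iff
proof (intro conjI ballI)
  show "Restr P U \<subseteq> topspace (subtopology X U) \<times> topspace (subtopology X U)"
    using openin_subset[OF U] by auto
next
  fix x assume x: "x \<in> topspace (subtopology X U)"
  then obtain T where T: "openin X T" "x \<in> T" "T \<subseteq> P `` {x}"
    using P by (auto simp: semi_neighborhoods_iff)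
  have "openin (subtopology X U) (T \<inter> U)"
    using T(1) by (auto simp: openin_subtopology)
  moreover have "x \<in> T \<inter> U" "T \<inter> U \<subseteq> Restr P U `` {x}"
    using T x by auto
  ultimately show "\<exists>T. openin (subtopology X U) T \<and> x \<in> T \<and> T \<subseteq> Restr P U `` {x}"
    by blast
qed

text \<open>
  The condition on a semi-neighborhood concerns each section separately. Sections at points of
  \<open>U\<close> stay neighborhoods because \<open>U\<close> is open, and those at the other points, boundary points of
  \<open>U\<close> included, may be chosen freely.
\<close>

lemma semi_neighborhoods_extend:
  assumes P: "P \<in> semi_neighborhoods (subtopology X U)" and U: "openin X U"
  shows "P \<union> (topspace X - U) \<times> topspace X \<in> semi_neighborhoods X"
  unfolding semi_neighborhoods_iff
proof (intro conjI ballI)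
  show "P \<union> (topspace X - U) \<times> topspace X \<subseteq> topspace X \<times> topspace X"
    using P by (auto simp: semi_neighborhoods_iff)
next
  fix x assume x: "x \<in> topspace X"
  show "\<exists>T. openin X T \<and> x \<in> T \<and> T \<subseteq> (P \<union> (topspace X - U) \<times> topspace X) `` {x}"
  proof (cases "x \<in> U")
    case True
    then obtain T where "openin (subtopology X U) T" "x \<in> T" "T \<subseteq> P `` {x}"
      using P x unfolding semi_neighborhoods_iff by (metis IntI topspace_subtopology)
    then show ?thesis
      using openin_trans_full[OF _ U] by blast
  next
    case False
    with x show ?thesis
      by (intro exI[of _ "topspace X"]) auto
  qed
qed

lemma semi_neighborhoods_vimage:
  assumes P: "P \<in> semi_neighborhoods Y" and f: "continuous_map X Y f"
  shows "{(x, x') \<in> topspace X \<times> topspace X. (f x, f x') \<in> P} \<in> semi_neighborhoods X"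
    (is "?P' \<in> _")
  unfolding semi_neighborhoods_iff
proof (intro conjI ballI)
  fix x assume x: "x \<in> topspace X"
  then have "f x \<in> topspace Y"
    using continuous_map_image_subset_topspace[OF f] by auto
  then obtain T where T: "openin Y T" "f x \<in> T" "T \<subseteq> P `` {f x}"
    using P by (auto simp: semi_neighborhoods_iff)
  have "openin X {x' \<in> topspace X. f x' \<in> T}"
    using openin_continuous_map_preimage[OF f T(1)] .
  with x T show "\<exists>T. openin X T \<and> x \<in> T \<and> T \<subseteq> ?P' `` {x}"
    by (intro exI[of _ "{x' \<in> topspace X. f x' \<in> T}"]) auto
qed auto

section \<open>Baire and nonmeager subspaces\<close>

lemma Delta_Baire_imp_nonmeager:
  assumes "topspace X \<noteq> {}" "Delta_Baire \<QQ> X"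
  shows "Delta_nonmeager \<QQ> X"
  unfolding Delta_nonmeager_def
proof
  fix P assume "P \<in> semi_neighborhoods X"
  with assms show "\<exists>V. openin X V \<and> V \<noteq> {} \<and> Restr P V \<in> \<QQ> (subtopology X V)"
    unfolding Delta_Baire_def by (meson openin_topspace)
qed

text \<open>
  Nonmeagerness and Baireness of an open subspace can be tested with semi-neighborhoods of the
  ambient space, by restriction and extension.
\<close>

lemma Delta_nonmeager_subtopology_iff:
  assumes U: "openin X U"
  shows "Delta_nonmeager \<QQ> (subtopology X U) \<longleftrightarrow>
    (\<forall>P\<in>semi_neighborhoods X.
       \<exists>V. openin X V \<and> V \<noteq> {} \<and> V \<subseteq> U \<and> Restr P V \<in> \<QQ> (subtopology X V))"
    (is "_ \<longleftrightarrow> ?ambient")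
proof -
  have sub: "subtopology (subtopology X U) V = subtopology X V" if "V \<subseteq> U" for V
    using that by (simp add: subtopology_subtopology Int_absorb1)
  have eq: "Restr (Restr P U) V = Restr P V" if "V \<subseteq> U" for P :: "('a \<times> 'a) set" and V
    using that by auto
  have ext: "Restr (P \<union> (topspace X - U) \<times> topspace X) V = Restr P V"
    if "V \<subseteq> U" for P V
    using that by auto
  show ?thesis
  proof
    assume nm: "Delta_nonmeager \<QQ> (subtopology X U)"
    show ?ambient
    proof
      fix P assume "P \<in> semi_neighborhoods X"
      from nm[unfolded Delta_nonmeager_def, rule_format, OF semi_neighborhoods_Restr[OF this U]]
      show "\<exists>V. openin X V \<and> V \<noteq> {} \<and> V \<subseteq> U \<and> Restr P V \<in> \<QQ> (subtopology X V)"
        using U eq sub by (metis openin_open_subtopology)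
    qed
  next
    assume amb: ?ambient
    show "Delta_nonmeager \<QQ> (subtopology X U)"
      unfolding Delta_nonmeager_def
    proof
      fix P assume "P \<in> semi_neighborhoods (subtopology X U)"
      from amb[rule_format, OF semi_neighborhoods_extend[OF this U]]
      show "\<exists>V. openin (subtopology X U) V \<and> V \<noteq> {} \<and>
          Restr P V \<in> \<QQ> (subtopology (subtopology X U) V)"
        using U ext sub by (metis openin_open_subtopology)
    qed
  qed
qed

lemma Delta_Baire_iff_nonmeager:
  "Delta_Baire \<QQ> X \<longleftrightarrow>
     (\<forall>U. openin X U \<and> U \<noteq> {} \<longrightarrow> Delta_nonmeager \<QQ> (subtopology X U))"
  unfolding Delta_Baire_def by (simp add: Delta_nonmeager_subtopology_iff cong: imp_cong) meson

lemma Delta_Baire_subtopology_iff: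
  assumes U: "openin X U"
  shows "Delta_Baire \<QQ> (subtopology X U) \<longleftrightarrow>
     (\<forall>W. openin X W \<and> W \<noteq> {} \<and> W \<subseteq> U \<longrightarrow> Delta_nonmeager \<QQ> (subtopology X W))"
proof -
  have "subtopology (subtopology X U) W = subtopology X W" if "W \<subseteq> U" for W
    using that by (simp add: subtopology_subtopology Int_absorb1)
  then show ?thesis
    unfolding Delta_Baire_iff_nonmeager openin_open_subtopology[OF U] by metis
qed

lemma Delta_Baire_subtopology:
  assumes "Delta_Baire \<QQ> X" "openin X U"
  shows "Delta_Baire \<QQ> (subtopology X U)"
  using assms by (auto simp: Delta_Baire_subtopology_iff Delta_Baire_iff_nonmeager[of \<QQ> X])

lemma Delta_nonmeager_if_open_subspace:
  assumes "openin X U" "Delta_nonmeager \<QQ> (subtopology X U)"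
  shows "Delta_nonmeager \<QQ> X"
  using assms(2) unfolding Delta_nonmeager_subtopology_iff[OF assms(1)]
  unfolding Delta_nonmeager_def by blast

section \<open>Gluing witnesses of meagerness\<close>

lemma normal_square_functor_Restr:
  assumes \<QQ>: "normal_square_functor \<QQ>"
    and "openin X W" "V \<noteq> {}" "openin X V" "V \<subseteq> W"
    and "Restr P W \<in> \<QQ> (subtopology X W)"
  shows "Restr P V \<in> \<QQ> (subtopology X V)"
proof -
  have "openin (subtopology X W) V" "topspace (subtopology X W) \<noteq> {}"
    using assms openin_subset[of X W] by (auto simp: openin_open_subtopology)
  with \<open>V \<noteq> {}\<close> have "\<QQ> (subtopology (subtopology X W) V) = {Restr S V | S. S \<in> \<QQ> (subtopology X W)}"
    using \<QQ>[unfolded normal_square_functor_def, THEN conjunct2, THEN conjunct2, THEN conjunct1,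
        rule_format, of "subtopology X W" V] by simp
  moreover have "Restr P V = Restr (Restr P W) V"
    using \<open>V \<subseteq> W\<close> by auto
  moreover have "subtopology (subtopology X W) V = subtopology X V"
    using \<open>V \<subseteq> W\<close> by (simp add: subtopology_subtopology Int_absorb1)
  ultimately show ?thesis
    using assms(6) by auto
qed

text \<open>
  Choosing at each point the first set of the family that contains it plays the role of a maximal
  disjoint subfamily in the usual proof of Banach's category theorem: on \<open>W \<inter> V\<close>, where \<open>V\<close> is
  the first member meeting \<open>W\<close>, the choice is constant.
\<close>

lemma ex_locally_constant_choice:
  obtains c :: "'a \<Rightarrow> 'a set"
  where "\<And>x. x \<in> \<Union>\<B> \<Longrightarrow> c x \<in> \<B> \<and> x \<in> c x"
    and "\<And>W. W \<inter> \<Union>\<B> \<noteq> {} \<Longrightarrow> \<exists>V\<in>\<B>. W \<inter> V \<noteq> {} \<and> (\<forall>x\<in>W \<inter> V. c x = V)"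
proof -
  obtain r :: "'a set rel" where r: "Well_order r" "Field r = UNIV"
    using well_ordering[where 'a = "'a set"] by blast
  interpret wo_rel r
    using r(1) by (simp add: wo_rel_def)
  define c where "c x = minim {V \<in> \<B>. x \<in> V}" for x
  show thesis
  proof
    fix x assume "x \<in> \<Union>\<B>"
    then have "{V \<in> \<B>. x \<in> V} \<noteq> {}" by auto
    from minim_in[OF _ this] show "c x \<in> \<B> \<and> x \<in> c x"
      by (simp add: r(2) c_def)
  next
    fix W :: "'a set" assume "W \<inter> \<Union>\<B> \<noteq> {}"
    then have ne: "{V \<in> \<B>. W \<inter> V \<noteq> {}} \<noteq> {}" by auto
    define V where "V = minim {V \<in> \<B>. W \<inter> V \<noteq> {}}"
    have V: "V \<in> \<B>" "W \<inter> V \<noteq> {}"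
      using minim_in[OF _ ne] by (simp_all add: r(2) V_def)
    have least: "(V, V') \<in> r" if "V' \<in> \<B>" "W \<inter> V' \<noteq> {}" for V'
      using minim_least[of "{V \<in> \<B>. W \<inter> V \<noteq> {}}" V'] that by (simp add: r(2) V_def)
    have "c x = V" if "x \<in> W \<inter> V" for x
      unfolding c_def
      by (rule equals_minim[symmetric]) (use that V least in \<open>auto simp: r(2)\<close>)
    with V show "\<exists>V\<in>\<B>. W \<inter> V \<noteq> {} \<and> (\<forall>x\<in>W \<inter> V. c x = V)" by blast
  qed
qed

text \<open>
  If no nonempty open subspace is Baire, the sets \<open>V \<in> \<B>\<close> that are not nonmeager lie below every
  nonempty open set. The glued relation \<open>P\<close> is a semi-neighborhood because each of its sections is
  a section of one of the witnesses or the whole space, and it defeats every open set \<open>W\<close> because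
  it coincides with a single witness on some nonempty open part of \<open>W\<close>.
\<close>

lemma nonmeager_imp_open_Baire:
  assumes \<QQ>: "normal_square_functor \<QQ>" and X: "Delta_nonmeager \<QQ> X"
  shows "\<exists>U. openin X U \<and> U \<noteq> {} \<and> Delta_Baire \<QQ> (subtopology X U)"
proof (rule ccontr)
  assume none: "\<not> ?thesis"
  define \<B> where
    "\<B> = {V. openin X V \<and> V \<noteq> {} \<and> \<not> Delta_nonmeager \<QQ> (subtopology X V)}"
  have dense: "\<exists>V\<in>\<B>. V \<subseteq> W" if "openin X W" "W \<noteq> {}" for W
    using none that Delta_Baire_subtopology_iff[OF that(1), of \<QQ>] unfolding \<B>_def by blast
  have "\<exists>P\<in>semi_neighborhoods X. \<forall>W. openin X W \<and> W \<noteq> {} \<and> W \<subseteq> V \<longrightarrow>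
      Restr P W \<notin> \<QQ> (subtopology X W)" if "V \<in> \<B>" for V
  proof -
    have V: "openin X V" "\<not> Delta_nonmeager \<QQ> (subtopology X V)"
      using that by (auto simp: \<B>_def)
    then show ?thesis
      unfolding Delta_nonmeager_subtopology_iff[OF V(1)] by blast
  qed
  then obtain p where p: "\<And>V. V \<in> \<B> \<Longrightarrow> p V \<in> semi_neighborhoods X"
    and bad: "\<And>V W. V \<in> \<B> \<Longrightarrow> openin X W \<Longrightarrow> W \<noteq> {} \<Longrightarrow> W \<subseteq> V \<Longrightarrow>
      Restr (p V) W \<notin> \<QQ> (subtopology X W)"
    by metis
  obtain c where c: "\<And>x. x \<in> \<Union>\<B> \<Longrightarrow> c x \<in> \<B> \<and> x \<in> c x"
    and const: "\<And>W. W \<inter> \<Union>\<B> \<noteq> {} \<Longrightarrow> \<exists>V\<in>\<B>. W \<inter> V \<noteq> {} \<and> (\<forall>x\<in>W \<inter> V. c x = V)"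
    using ex_locally_constant_choice[of \<B>] by metis
  define P where
    "P = {(x, y) \<in> topspace X \<times> topspace X. x \<in> \<Union>\<B> \<longrightarrow> (x, y) \<in> p (c x)}"
  have P: "P \<in> semi_neighborhoods X"
    unfolding semi_neighborhoods_iff
  proof (intro conjI ballI)
    fix x assume x: "x \<in> topspace X"
    show "\<exists>T. openin X T \<and> x \<in> T \<and> T \<subseteq> P `` {x}"
    proof (cases "x \<in> \<Union>\<B>")
      case True
      then have pc: "p (c x) \<in> semi_neighborhoods X"
        using c p by blast
      then obtain T where T: "openin X T" "x \<in> T" "T \<subseteq> p (c x) `` {x}"
        using x by (auto simp: semi_neighborhoods_iff)
      then have "T \<subseteq> P `` {x}"
        using x openin_subset[OF T(1)] by (auto simp: P_def)
      with T show ?thesis by blast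
    next
      case False
      with x show ?thesis
        by (intro exI[of _ "topspace X"]) (auto simp: P_def)
    qed
  qed (auto simp: P_def)
  from X P obtain W where W: "openin X W" "W \<noteq> {}" "Restr P W \<in> \<QQ> (subtopology X W)"
    unfolding Delta_nonmeager_def by blast
  have "W \<inter> \<Union>\<B> \<noteq> {}"
  proof -
    obtain V where "V \<in> \<B>" "V \<subseteq> W" using dense[OF W(1,2)] by blast
    then show ?thesis unfolding \<B>_def by blast
  qed
  from const[OF this] obtain V where V: "V \<in> \<B>" "W \<inter> V \<noteq> {}"
    and cV: "\<And>x. x \<in> W \<inter> V \<Longrightarrow> c x = V"
    by auto
  have op: "openin X (W \<inter> V)"
    using W V by (auto simp: \<B>_def)
  have "Restr P (W \<inter> V) = Restr (p V) (W \<inter> V)"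
    using cV V(1) openin_subset[OF W(1)] by (auto simp: P_def)
  moreover have "Restr P (W \<inter> V) \<in> \<QQ> (subtopology X (W \<inter> V))"
    using normal_square_functor_Restr[OF \<QQ> W(1) V(2) op _ W(3)] by blast
  ultimately show False
    using bad[OF V(1) op V(2)] by auto
qed

section \<open>Homeomorphisms and homogeneous spaces\<close>

lemma normal_square_functor_image:
  assumes \<QQ>: "normal_square_functor \<QQ>" and f: "homeomorphic_map X Y f"
    and V: "openin X V" "V \<noteq> {}"
    and S: "S \<in> \<QQ> (subtopology X V)"
  shows "map_prod f f ` S \<in> \<QQ> (subtopology Y (f ` V))"
proof -
  have VX: "V \<subseteq> topspace X"
    using openin_subset[OF V(1)] .
  have "f ` V \<subseteq> topspace Y"
    using VX homeomorphic_imp_surjective_map[OF f] by blast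
  with V(2) VX have ne: "topspace (subtopology X V) \<noteq> {}" "topspace (subtopology Y (f ` V)) \<noteq> {}"
    by auto
  have hV: "homeomorphic_map (subtopology X V) (subtopology Y (f ` V)) f"
    using f VX homeomorphic_imp_surjective_map[OF f] homeomorphic_imp_injective_map[OF f]
    by (intro homeomorphic_map_subtopologies) (auto simp: inj_on_def)
  have "\<QQ> (subtopology Y (f ` V)) = {map_prod f f ` P | P. P \<in> \<QQ> (subtopology X V)}"
    using \<QQ>[unfolded normal_square_functor_def, THEN conjunct2, THEN conjunct1, rule_format,
        OF conjI[OF ne(1) conjI[OF ne(2) hV]]] .
  with S show ?thesis by blast
qed

lemma Delta_Baire_homeomorphic_image:
  assumes \<QQ>: "normal_square_functor \<QQ>" and f: "homeomorphic_map X Y f"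
    and X: "Delta_Baire \<QQ> X"
  shows "Delta_Baire \<QQ> Y"
  unfolding Delta_Baire_def
proof (intro ballI allI impI)
  fix P U assume P: "P \<in> semi_neighborhoods Y" and U: "openin Y U \<and> U \<noteq> {}"
  \<comment> \<open>The pullback of \<open>P\<close> along \<open>f\<close>; a set \<open>V\<close> that is good for it has an image good for \<open>P\<close>.\<close>
  define P' where "P' = {(x, x') \<in> topspace X \<times> topspace X. (f x, f x') \<in> P}"
  have cont: "continuous_map X Y f"
    using f by (rule homeomorphic_imp_continuous_map)
  define U' where "U' = {x \<in> topspace X. f x \<in> U}"
  have "P' \<in> semi_neighborhoods X"
    unfolding P'_def using P cont by (rule semi_neighborhoods_vimage)
  moreover have "openin X U'"
    unfolding U'_def using openin_continuous_map_preimage[OF cont] U by blast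
  moreover have "U' \<noteq> {}"
  proof -
    obtain y where "y \<in> U" using U by blast
    then have "y \<in> f ` topspace X"
      using U openin_subset[of Y U] homeomorphic_imp_surjective_map[OF f] by auto
    with \<open>y \<in> U\<close> show ?thesis by (auto simp: U'_def)
  qed
  ultimately obtain V where V: "openin X V" "V \<noteq> {}" "V \<subseteq> U'"
    and Q: "Restr P' V \<in> \<QQ> (subtopology X V)"
    using X unfolding Delta_Baire_def by metis
  have "map_prod f f ` Restr P' V = Restr P (f ` V)"
    using V(3) by (fastforce simp: P'_def U'_def)
  then have "Restr P (f ` V) \<in> \<QQ> (subtopology Y (f ` V))"
    using normal_square_functor_image[OF \<QQ> f V(1,2) Q] by simp
  moreover have "openin Y (f ` V)"
    using homeomorphic_map_openness[OF f openin_subset[OF V(1)]] V(1) by simp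
  ultimately show "\<exists>V. openin Y V \<and> V \<noteq> {} \<and> V \<subseteq> U \<and> Restr P V \<in> \<QQ> (subtopology Y V)"
    using V(2,3) by (intro exI[of _ "f ` V"]) (auto simp: U'_def)
qed

text \<open>
  Given an open set \<open>W\<close>, a homeomorphism moves an open Baire subspace \<open>U\<close> so that it meets \<open>W\<close>. The
  intersection is open in a Baire space, hence nonmeager, and \<open>W\<close> inherits nonmeagerness from it.
\<close>

lemma homogeneous_nonmeager_imp_Baire:
  assumes \<QQ>: "normal_square_functor \<QQ>" and hom: "homogeneous_space X"
    and X: "Delta_nonmeager \<QQ> X"
  shows "Delta_Baire \<QQ> X"
  unfolding Delta_Baire_iff_nonmeager
proof (intro allI impI)
  fix W assume W: "openin X W \<and> W \<noteq> {}"
  obtain U where U: "openin X U" "U \<noteq> {}" "Delta_Baire \<QQ> (subtopology X U)"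
    using nonmeager_imp_open_Baire[OF \<QQ> X] by blast
  obtain x y where xy: "x \<in> U" "y \<in> W" using U W by blast
  then have "x \<in> topspace X" "y \<in> topspace X"
    using openin_subset[OF U(1)] openin_subset[of X W] W by auto
  then obtain f where f: "homeomorphic_map X X f" "f x = y"
    using hom unfolding homogeneous_space_def by metis
  have fU: "openin X (f ` U)"
    using homeomorphic_map_openness[OF f(1) openin_subset[OF U(1)]] U(1) by simp
  have "homeomorphic_map (subtopology X U) (subtopology X (f ` U)) f"
    using f(1) openin_subset[OF U(1)] homeomorphic_imp_surjective_map[OF f(1)]
      homeomorphic_imp_injective_map[OF f(1)]
    by (intro homeomorphic_map_subtopologies) (auto simp: inj_on_def)
  then have "Delta_Baire \<QQ> (subtopology X (f ` U))"
    using Delta_Baire_homeomorphic_image[OF \<QQ>] U(3) by blast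
  moreover have "openin X (f ` U \<inter> W)" "f ` U \<inter> W \<noteq> {}"
    using fU W xy f(2) by auto
  ultimately have "Delta_nonmeager \<QQ> (subtopology X (f ` U \<inter> W))"
    unfolding Delta_Baire_subtopology_iff[OF fU] by blast
  then have "Delta_nonmeager \<QQ> (subtopology (subtopology X W) (f ` U \<inter> W))"
    by (simp add: subtopology_subtopology inf.absorb2)
  moreover have "openin (subtopology X W) (f ` U \<inter> W)"
    using W \<open>openin X (f ` U \<inter> W)\<close> by (simp add: openin_open_subtopology)
  ultimately show "Delta_nonmeager \<QQ> (subtopology X W)"
    by (metis Delta_nonmeager_if_open_subspace)
qed

section \<open>Relations between Baire and nonmeager spaces\<close>

theorem theorem3p1:
  fixes \<QQ> :: "'a topology \<Rightarrow> ('a \<times> 'a) set set"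
  assumes "normal_square_functor \<QQ>"
  shows
    "(\<forall>X. topspace X \<noteq> {} \<and> Delta_Baire \<QQ> X \<longrightarrow> Delta_nonmeager \<QQ> X) \<and>
     (\<forall>X U. topspace X \<noteq> {} \<and> Delta_Baire \<QQ> X \<and> openin X U \<and> U \<noteq> {} \<longrightarrow>
        Delta_Baire \<QQ> (subtopology X U)) \<and>
     (\<forall>X. topspace X \<noteq> {} \<longrightarrow>
        (Delta_Baire \<QQ> X \<longleftrightarrow>
         (\<forall>U. openin X U \<and> U \<noteq> {} \<longrightarrow> Delta_nonmeager \<QQ> (subtopology X U)))) \<and>
     (\<forall>X. topspace X \<noteq> {} \<longrightarrow>
        (Delta_nonmeager \<QQ> X \<longleftrightarrow>
         (\<exists>U. openin X U \<and> U \<noteq> {} \<and> Delta_Baire \<QQ> (subtopology X U)))) \<and>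
     (\<forall>X. topspace X \<noteq> {} \<and> homogeneous_space X \<and> Delta_nonmeager \<QQ> X \<longrightarrow> Delta_Baire \<QQ> X)"
proof (intro conjI)
  show "\<forall>X. topspace X \<noteq> {} \<and> Delta_Baire \<QQ> X \<longrightarrow> Delta_nonmeager \<QQ> X"
    by (simp add: Delta_Baire_imp_nonmeager)
  show "\<forall>X U. topspace X \<noteq> {} \<and> Delta_Baire \<QQ> X \<and> openin X U \<and> U \<noteq> {} \<longrightarrow>
      Delta_Baire \<QQ> (subtopology X U)"
    by (simp add: Delta_Baire_subtopology)
  show "\<forall>X. topspace X \<noteq> {} \<longrightarrow>
      (Delta_Baire \<QQ> X \<longleftrightarrow>
       (\<forall>U. openin X U \<and> U \<noteq> {} \<longrightarrow> Delta_nonmeager \<QQ> (subtopology X U)))"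
    by (simp add: Delta_Baire_iff_nonmeager)
  show "\<forall>X. topspace X \<noteq> {} \<longrightarrow>
      (Delta_nonmeager \<QQ> X \<longleftrightarrow>
       (\<exists>U. openin X U \<and> U \<noteq> {} \<and> Delta_Baire \<QQ> (subtopology X U)))"
  proof (intro allI impI iffI)
    fix X assume "Delta_nonmeager \<QQ> X"
    then show "\<exists>U. openin X U \<and> U \<noteq> {} \<and> Delta_Baire \<QQ> (subtopology X U)"
      by (rule nonmeager_imp_open_Baire[OF assms])
  next
    fix X assume "\<exists>U. openin X U \<and> U \<noteq> {} \<and> Delta_Baire \<QQ> (subtopology X U)"
    then obtain U where U: "openin X U" "U \<noteq> {}" "Delta_Baire \<QQ> (subtopology X U)"
      by blast
    then have "Delta_nonmeager \<QQ> (subtopology X U)"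
      by (simp add: Delta_Baire_subtopology_iff)
    with U(1) show "Delta_nonmeager \<QQ> X"
      by (rule Delta_nonmeager_if_open_subspace)
  qed
  show "\<forall>X. topspace X \<noteq> {} \<and> homogeneous_space X \<and> Delta_nonmeager \<QQ> X \<longrightarrow> Delta_Baire \<QQ> X"
    by (simp add: homogeneous_nonmeager_imp_Baire[OF assms])
qed

end
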